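(* Let $\lambda$ be a nonzero real number. For every integer $k\ge 0$, the generating function of the heterogeneous Stirling numbers of the second kind is given by the identity of formal power series in $t$ $$\frac{1}{k!}\big(e_{\lambda}^{-1}(-t)-1\big)^{k}=\sum_{n=k}^{\infty}H_{\lambda}(n,k)\frac{t^{n}}{n!}.$$
   Context: For $\lambda\in\mathbb{R}$, $\lambda\neq 0$: $(x)_{0,\lambda}=1$, $(x)_{n,\lambda}=x(x-\lambda)\cdots(x-(n-1)\lambda)$ for $n\ge 1$; $\langle x\rangle_{0,\lambda}=1$, $\langle x\rangle_{n,\lambda}=x(x+\lambda)\cdots(x+(n-1)\lambda)$ for $n\ge 1$. The falling factorial is $(x)_0=1$, $(x)_n=x(x-1)\cdots(x-n+1)$ for $n\ge 1$. The degenerate exponential is the series $e_{\lambda}^{x}(t)=\sum_{n=0}^{\infty}(x)_{n,\lambda}\frac{t^n}{n!}$ (that is, $(1+\lambda t)^{x/\lambda}$); $e_\lambda^{-1}(-t)$ denotes $e_\lambda^{x}(s)$ at $x=-1$, $s=-t$ (that is, $(1-\lambda t)^{-1/\lambda}$). The heterogeneous Stirling numbers of the second kind $H_\lambda(n,k)$ are defined by the polynomial identity $\langle x\rangle_{n,\lambda}=\sum_{k=0}^{n}H_{\lambda}(n,k)(x)_{k}$ for $n\ge 0$, with $H_\lambda(n,k)=0$ for $k<0$ or $n<k$. *)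

theory Defs
  imports
    Complex_Main
    "HOL-Computational_Algebra.Polynomial"
    "HOL-Computational_Algebra.Formal_Power_Series"
begin

text \<open>
  The factorials are defined over an arbitrary commutative ring, so that they can be used
  both for real numbers and for an indeterminate, i.e. with \<open>x = [:0, 1:]\<close> and
  \<open>lam = [:c:]\<close> in \<open>real poly\<close>.
\<close>

definition ffact :: "'a::comm_ring_1 \<Rightarrow> nat \<Rightarrow> 'a" where
  "ffact x n = (\<Prod>i<n. x - of_nat i)"

definition deg_ffact :: "'a::comm_ring_1 \<Rightarrow> 'a \<Rightarrow> nat \<Rightarrow> 'a" where
  "deg_ffact lam x n = (\<Prod>i<n. x - of_nat i * lam)"

definition deg_rfact :: "'a::comm_ring_1 \<Rightarrow> 'a \<Rightarrow> nat \<Rightarrow> 'a" where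
  "deg_rfact lam x n = (\<Prod>i<n. x + of_nat i * lam)"

definition deg_exp :: "real \<Rightarrow> real \<Rightarrow> real fps" where
  "deg_exp lam x = Abs_fps (\<lambda>n. deg_ffact lam x n / fact n)"

definition is_hetero_stirling2 :: "real \<Rightarrow> (nat \<Rightarrow> nat \<Rightarrow> real) \<Rightarrow> bool" where
  "is_hetero_stirling2 lam H \<longleftrightarrow>
     (\<forall>n. deg_rfact [:lam:] [:0, 1:] n = (\<Sum>k\<le>n. smult (H n k) (ffact [:0, 1:] k))) \<and>
     (\<forall>n k. n < k \<longrightarrow> H n k = 0)"

definition hetero_stirling2 :: "real \<Rightarrow> nat \<Rightarrow> nat \<Rightarrow> real" where
  "hetero_stirling2 lam = (THE H. is_hetero_stirling2 lam H)"


text \<open>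
  The falling factorials form a basis of the polynomials, so the description above determines
  the numbers uniquely.
\<close>

lemma poly_ffact_of_nat: "poly (ffact [:0, 1:] k) (of_nat m :: real) = ffact (of_nat m) k"
  by (simp add: ffact_def poly_prod)

lemma ffact_of_nat_eq_0: "m < k \<Longrightarrow> ffact (of_nat m :: real) k = 0"
  unfolding ffact_def by (rule prod_zero) auto

lemma ffact_of_nat_nonzero: "ffact (of_nat m :: real) m \<noteq> 0"
  by (simp add: ffact_def)

lemma ffact_basis_unique:
  fixes a b :: "nat \<Rightarrow> real"
  assumes eq: "(\<Sum>k\<le>n. smult (a k) (ffact [:0, 1:] k)) = (\<Sum>k\<le>n. smult (b k) (ffact [:0, 1:] k))"
    and "m \<le> n"
  shows "a m = b m"
  using \<open>m \<le> n\<close>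
proof (induction m rule: less_induct)
  case (less m)
  have ev: "poly (\<Sum>k\<le>n. smult (c k) (ffact [:0, 1:] k)) (of_nat m) =
      (\<Sum>k<m. c k * ffact (of_nat m) k) + c m * ffact (of_nat m) m" for c :: "nat \<Rightarrow> real"
  proof -
    have "poly (\<Sum>k\<le>n. smult (c k) (ffact [:0, 1:] k)) (of_nat m) =
        (\<Sum>k\<le>n. c k * ffact (of_nat m) k)"
      by (simp add: poly_sum poly_ffact_of_nat)
    also have "\<dots> = (\<Sum>k\<le>m. c k * ffact (of_nat m) k)"
      using less.prems by (intro sum.mono_neutral_right) (auto simp: ffact_of_nat_eq_0)
    finally show ?thesis by (simp add: lessThan_Suc_atMost[symmetric])
  qed
  have "(\<Sum>k<m. a k * ffact (of_nat m) k) = (\<Sum>k<m. b k * ffact (of_nat m :: real) k)"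
    using less by (intro sum.cong) auto
  with eq ev[of a] ev[of b] have "a m * ffact (of_nat m) m = b m * ffact (of_nat m) m"
    by (metis add_left_cancel)
  then show ?case using ffact_of_nat_nonzero[of m] by simp
qed

lemma hetero_stirling2_ex: "\<exists>H. is_hetero_stirling2 lam H"
proof -
  have "\<exists>a :: nat \<Rightarrow> real. deg_rfact [:lam:] [:0, 1:] n = (\<Sum>k\<le>n. smult (a k) (ffact [:0, 1:] k))
      \<and> (\<forall>k>n. a k = 0)" for n
  proof (induction n)
    case 0
    show ?case
      by (rule exI[of _ "\<lambda>k. if k = 0 then 1 else 0"]) (simp add: deg_rfact_def ffact_def)
  next
    case (Suc n)
    then obtain a :: "nat \<Rightarrow> real" where
      a: "deg_rfact [:lam:] [:0, 1:] n = (\<Sum>k\<le>n. smult (a k) (ffact [:0, 1:] k))"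
      and a0: "\<And>k. k > n \<Longrightarrow> a k = 0" by blast
    define b where "b k = (case k of 0 \<Rightarrow> 0 | Suc j \<Rightarrow> a j) + (of_nat k + of_nat n * lam) * a k" for k
    let ?f = "ffact [:0, 1:] :: nat \<Rightarrow> real poly"
    have step: "?f k * ([:0, 1:] + of_nat n * [:lam:]) =
        ?f (Suc k) + smult (of_nat k + of_nat n * lam) (?f k)" for k
    proof -
      have c: "[:0, 1:] + of_nat n * [:lam:] =
          ([:0, 1:] - of_nat k) + [:of_nat k + of_nat n * lam:]"
        by (simp add: of_nat_poly)
      show ?thesis
        unfolding c by (simp add: ffact_def distrib_left)
    qed
    have "deg_rfact [:lam:] [:0, 1:] (Suc n) =
        (\<Sum>k\<le>n. smult (a k) (?f k)) * ([:0, 1:] + of_nat n * [:lam:])"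
      unfolding a[symmetric] by (simp add: deg_rfact_def)
    also have "\<dots> = (\<Sum>k\<le>n. smult (a k) (?f k * ([:0, 1:] + of_nat n * [:lam:])))"
      by (simp only: sum_distrib_right mult_smult_left)
    also have "\<dots> = (\<Sum>k\<le>n. smult (a k) (?f (Suc k))) +
        (\<Sum>k\<le>n. smult ((of_nat k + of_nat n * lam) * a k) (?f k))"
      by (simp only: step smult_add_right sum.distrib smult_smult mult.commute)
    also have "(\<Sum>k\<le>n. smult (a k) (?f (Suc k))) =
        (\<Sum>k\<le>Suc n. smult (case k of 0 \<Rightarrow> 0 | Suc j \<Rightarrow> a j) (?f k))"
      by (simp add: sum.atMost_Suc_shift del: sum.atMost_Suc)
    also have "(\<Sum>k\<le>n. smult ((of_nat k + of_nat n * lam) * a k) (?f k)) =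
        (\<Sum>k\<le>Suc n. smult ((of_nat k + of_nat n * lam) * a k) (?f k))"
      by (simp add: a0)
    finally have "deg_rfact [:lam:] [:0, 1:] (Suc n) = (\<Sum>k\<le>Suc n. smult (b k) (?f k))"
      by (simp only: b_def smult_add_left sum.distrib)
    moreover have "\<forall>k>Suc n. b k = 0"
      by (auto simp: b_def a0 split: nat.split)
    ultimately show ?case by blast
  qed
  then show ?thesis
    unfolding is_hetero_stirling2_def by metis
qed

lemma is_hetero_stirling2_unique:
  assumes "is_hetero_stirling2 lam H" "is_hetero_stirling2 lam H'"
  shows "H = H'"
proof (intro ext)
  fix n k
  show "H n k = H' n k"
  proof (cases "k \<le> n")
    case True
    then show ?thesis
      using assms ffact_basis_unique[where n = n and a = "H n" and b = "H' n" and m = k]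
      unfolding is_hetero_stirling2_def by metis
  next
    case False
    then show ?thesis
      using assms unfolding is_hetero_stirling2_def by (metis not_le)
  qed
qed

lemma is_hetero_stirling2_hetero_stirling2: "is_hetero_stirling2 lam (hetero_stirling2 lam)"
  unfolding hetero_stirling2_def
  by (metis (no_types) hetero_stirling2_ex is_hetero_stirling2_unique theI)

end

theory Submission
  imports Defs
begin

text \<open>
  Let \<open>E\<close> be the series of \<open>(1 - lam t) powr (-1 / lam)\<close> and \<open>F k = (E - 1) ^ k / k!\<close>. From
  \<open>(1 - lam t) E' = E\<close> one gets \<open>(1 - lam t) (F k)' = k (F k) + F (k - 1)\<close>, which on coefficients
  is the triangular recurrence
  \<open>H (n + 1) k = H n (k - 1) + (k + n lam) H n k\<close>. The same recurrence comes from expanding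
  \<open>(x)\<^sub>k (x + n lam) = (x)\<^sub>k\<^sub>+\<^sub>1 + (k + n lam) (x)\<^sub>k\<close>, so the coefficients of
  \<open>F k\<close> satisfy the polynomial identity that characterises the heterogeneous Stirling numbers.
\<close>

lemma deg_rfact_Suc: "deg_rfact lam x (Suc n) = deg_rfact lam x n * (x + of_nat n * lam)"
  by (simp add: deg_rfact_def)

lemma ffact_mult_linear:
  "ffact [:0, 1:] k * ([:0, 1:] + of_nat n * [:lam:]) =
     ffact [:0, 1:] (Suc k) + smult (of_nat k + of_nat n * lam) (ffact [:0, 1:] k)"
  for lam :: real
proof -
  have split: "[:0, 1:] + of_nat n * [:lam:] = ([:0, 1:] - of_nat k) + [:of_nat k + of_nat n * lam:]"
    by (simp add: of_nat_poly)
  show ?thesis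
    unfolding split by (simp add: ffact_def distrib_left)
qed

lemma is_hetero_stirling2I:
  assumes zero: "H 0 0 = 1"
    and step: "\<And>n k. H (Suc n) k =
      (case k of 0 \<Rightarrow> 0 | Suc j \<Rightarrow> H n j) + (of_nat k + of_nat n * lam) * H n k"
    and vanish: "\<And>n k. n < k \<Longrightarrow> H n k = 0"
  shows "is_hetero_stirling2 lam H"
proof -
  let ?f = "ffact [:0, 1:] :: nat \<Rightarrow> real poly"
  have "deg_rfact [:lam:] [:0, 1:] n = (\<Sum>k\<le>n. smult (H n k) (?f k))" for n
  proof (induction n)
    case 0
    show ?case by (simp add: zero deg_rfact_def ffact_def)
  next
    case (Suc n)
    have "deg_rfact [:lam:] [:0, 1:] (Suc n) =
        (\<Sum>k\<le>n. smult (H n k) (?f k * ([:0, 1:] + of_nat n * [:lam:])))"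
      by (simp only: deg_rfact_Suc Suc.IH sum_distrib_right mult_smult_left)
    also have "\<dots> = (\<Sum>k\<le>n. smult (H n k) (?f (Suc k))) +
        (\<Sum>k\<le>n. smult ((of_nat k + of_nat n * lam) * H n k) (?f k))"
      by (simp only: ffact_mult_linear smult_add_right sum.distrib smult_smult mult.commute)
    \<comment> \<open>Reindexing by \<open>k + 1\<close> leaves nothing at \<open>k = 0\<close>,
      hence the default 0 in the case expression.\<close>
    also have "(\<Sum>k\<le>n. smult (H n k) (?f (Suc k))) =
        (\<Sum>k\<le>Suc n. smult (case k of 0 \<Rightarrow> 0 | Suc j \<Rightarrow> H n j) (?f k))"
      by (simp add: sum.atMost_Suc_shift del: sum.atMost_Suc)
    \<comment> \<open>The extra term at \<open>k = Suc n\<close> is zero because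
      \<open>H n (Suc n) = 0\<close>.\<close>
    also have "(\<Sum>k\<le>n. smult ((of_nat k + of_nat n * lam) * H n k) (?f k)) =
        (\<Sum>k\<le>Suc n. smult ((of_nat k + of_nat n * lam) * H n k) (?f k))"
      by (simp add: vanish)
    finally show ?case
      by (simp only: step smult_add_left sum.distrib)
  qed
  with vanish show ?thesis
    unfolding is_hetero_stirling2_def by blast
qed

text \<open>Substituting \<open>-t\<close> contributes \<open>(-1) ^ n\<close>, one sign for each of
  the \<open>n\<close> factors \<open>x - i lam\<close>.\<close>

lemma deg_exp_compose_uminus_nth:
  "fps_nth (fps_compose (deg_exp lam x) (- fps_X)) n = deg_rfact lam (- x) n / fact n"
proof -
  have "(-1) ^ n * deg_ffact lam x n = deg_rfact lam (- x) n"
    unfolding deg_ffact_def deg_rfact_def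
    by (induction n) (simp_all add: algebra_simps)
  then show ?thesis
    using fps_nth_compose_linear[of "deg_exp lam x" "-1" n]
    by (simp add: deg_exp_def flip: fps_const_neg)
qed

text \<open>On coefficients this is the passage from one degenerate rising factorial of
  \<open>- x\<close> to the next, by the factor \<open>- x + n lam\<close>.\<close>

lemma deg_exp_compose_uminus_deriv:
  fixes lam x :: real
  defines "E \<equiv> fps_compose (deg_exp lam x) (- fps_X)"
  shows "(1 - fps_const lam * fps_X) * fps_deriv E = fps_const (- x) * E"
proof (rule fps_ext)
  fix n
  have "of_nat (Suc n) * fps_nth E (Suc n) = (- x + of_nat n * lam) * fps_nth E n"
    by (simp add: E_def deg_exp_compose_uminus_nth deg_rfact_Suc field_simps del: of_nat_Suc)
  then show "fps_nth ((1 - fps_const lam * fps_X) * fps_deriv E) n = fps_nth (fps_const (- x) * E) n"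
    by (cases n) (simp_all add: algebra_simps mult.assoc)
qed

lemma hetero_stirling2_eq_fps_nth:
  fixes lam :: real
  defines "E \<equiv> fps_compose (deg_exp lam (-1)) (- fps_X)"
  defines "F \<equiv> (\<lambda>k. fps_const (1 / fact k) * (E - 1) ^ k)"
  shows "hetero_stirling2 lam n k = fact n * fps_nth (F k) n"
proof -
  define H where "H n k = fact n * fps_nth (F k) n" for n k
  \<comment> \<open>Hence \<open>(E - 1) ^ k\<close> has no terms below \<open>t^k\<close>, which
    gives \<open>H n k = 0\<close> for \<open>n < k\<close>.\<close>
  have E0: "fps_nth (E - 1) 0 = 0"
    by (simp add: E_def deg_exp_def deg_ffact_def)
  have E': "(1 - fps_const lam * fps_X) * fps_deriv E = E"
    using deg_exp_compose_uminus_deriv[of lam "-1"] by (simp add: E_def)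
  \<comment> \<open>For \<open>k = 0\<close> both sides vanish, since \<open>F 0 = 1\<close>; so
    \<open>F (k - 1)\<close> is read as 0 there.\<close>
  have ode: "(1 - fps_const lam * fps_X) * fps_deriv (F k) =
      fps_const (of_nat k) * F k + (case k of 0 \<Rightarrow> 0 | Suc j \<Rightarrow> F j)" for k
  proof (cases k)
    case 0
    then show ?thesis by (simp add: F_def)
  next
    case (Suc j)
    have c: "fps_const (of_nat (Suc j)) * fps_const (1 / fact (Suc j)) =
        (fps_const (1 / fact j) :: real fps)"
      by (simp add: field_simps del: of_nat_Suc)
    have "(1 - fps_const lam * fps_X) * fps_deriv (F k) =
        (fps_const (of_nat (Suc j)) * fps_const (1 / fact (Suc j))) *
          ((1 - fps_const lam * fps_X) * fps_deriv E) * (E - 1) ^ j"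
      by (simp add: F_def Suc fps_deriv_power' fps_of_nat ac_simps
          del: of_nat_Suc fact_Suc fps_const_mult power_Suc)
    \<comment> \<open>Writing \<open>E = (E - 1) + 1\<close> turns \<open>E * (E - 1) ^ j\<close>
      into two powers of \<open>E - 1\<close>.\<close>
    also have "\<dots> = (fps_const (of_nat (Suc j)) * fps_const (1 / fact (Suc j))) *
          ((E - 1) ^ Suc j + (E - 1) ^ j)"
      unfolding E' by (simp add: algebra_simps del: of_nat_Suc fact_Suc fps_const_mult)
    also have "\<dots> = fps_const (of_nat k) * F k + F j"
      unfolding distrib_left by (simp only: c) (simp only: F_def Suc c mult.assoc[symmetric])
    finally show ?thesis by (simp add: Suc)
  qed
  have "is_hetero_stirling2 lam H"
  proof (rule is_hetero_stirling2I)
    show "H 0 0 = 1" by (simp add: H_def F_def)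
    show "H n k = 0" if "n < k" for n k
      using startsby_zero_power_prefix[OF E0, of k] that by (simp add: H_def F_def)
    show "H (Suc n) k =
        (case k of 0 \<Rightarrow> 0 | Suc j \<Rightarrow> H n j) + (of_nat k + of_nat n * lam) * H n k" for n k
    proof -
      \<comment> \<open>Comparing coefficients of \<open>t^n\<close> in \<open>ode\<close>: the part
        \<open>lam t (F k)'\<close> yields the summand \<open>n lam\<close>.\<close>
      have "of_nat (Suc n) * fps_nth (F k) (Suc n) =
          fps_nth (case k of 0 \<Rightarrow> 0 | Suc j \<Rightarrow> F j) n + (of_nat k + of_nat n * lam) * fps_nth (F k) n"
        using arg_cong[OF ode[of k], of "\<lambda>f. fps_nth f n"]
        by (cases n) (simp_all add: algebra_simps mult.assoc)
      from arg_cong[OF this, of "\<lambda>y. fact n * y"] show ?thesis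
        by (simp add: H_def algebra_simps split: nat.split)
    qed
  qed
  then have "hetero_stirling2 lam = H"
    using is_hetero_stirling2_hetero_stirling2 is_hetero_stirling2_unique by blast
  then show ?thesis by (simp add: H_def)
qed

theorem theorem2p1:
  fixes lam :: real and k :: nat
  assumes "lam \<noteq> 0"
  shows "fps_const (1 / fact k) * (fps_compose (deg_exp lam (-1)) (- fps_X) - 1) ^ k =
    Abs_fps (\<lambda>n. if k \<le> n then hetero_stirling2 lam n k / fact n else 0)"
proof (rule fps_ext)
  fix n
  \<comment> \<open>This matches the default 0 that encodes a sum starting at
    \<open>n = k\<close>.\<close>
  have "hetero_stirling2 lam n k = 0" if "n < k"
    using is_hetero_stirling2_hetero_stirling2 that unfolding is_hetero_stirling2_def by blast
  then show "fps_nth (fps_const (1 / fact k) * (fps_compose (deg_exp lam (-1)) (- fps_X) - 1) ^ k) n =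
      fps_nth (Abs_fps (\<lambda>n. if k \<le> n then hetero_stirling2 lam n k / fact n else 0)) n"
    using hetero_stirling2_eq_fps_nth[of lam n k] by auto
qed

end
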